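(* Let $\alpha,\beta\in\mathbb{R}$ with $\alpha\neq 0$, and let $(G_1,g,J)$ be the connected three-dimensional unimodular Lie group with left-invariant Lorentzian metric $g$ whose Lie algebra has a pseudo-orthonormal basis $\{e_1,e_2,e_3\}$, $e_3$ timelike, with $$[e_1,e_2]=\alpha e_1-\beta e_3,\quad [e_1,e_3]=-\alpha e_1-\beta e_2,\quad [e_2,e_3]=\beta e_1+\alpha e_2+\alpha e_3,$$ and with the product structure $J$ given by $Je_1=e_1$, $Je_2=e_2$, $Je_3=-e_3$. Then $(G_1,g,J)$ does not admit left-invariant Ricci collineations associated to the canonical connection $\nabla^0$.
   Context: Pseudo-orthonormal with $e_3$ timelike means $g(e_1,e_1)=g(e_2,e_2)=1$, $g(e_3,e_3)=-1$, $g(e_i,e_j)=0$ for $i\ne j$. $J$ is extended left-invariantly to a $(1,1)$-tensor with $J^2=\mathrm{id}$. Let $\nabla$ be the Levi-Civita connection of $g$. The canonical connection is $$\nabla^0_XY=\nabla_XY-\tfrac12(\nabla_XJ)JY,$$ with curvature $R^0(X,Y)Z=\nabla^0_X\nabla^0_YZ-\nabla^0_Y\nabla^0_XZ-\nabla^0_{[X,Y]}Z$. Its Ricci tensor is $$\mathrm{Ric}^0(X,Y)=-g(R^0(X,e_1)Y,e_1)-g(R^0(X,e_2)Y,e_2)+g(R^0(X,e_3)Y,e_3),$$ and its symmetrization is $\widetilde{\mathrm{Ric}}^0(X,Y)=\frac12\big(\mathrm{Ric}^0(X,Y)+\mathrm{Ric}^0(Y,X)\big)$. For a left-invariant vector field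 $\xi=\lambda_1e_1+\lambda_2e_2+\lambda_3e_3$ ($\lambda_i\in\mathbb{R}$), $$(L_\xi\widetilde{\mathrm{Ric}}^0)(X,Y)=\xi\big(\widetilde{\mathrm{Ric}}^0(X,Y)\big)-\widetilde{\mathrm{Ric}}^0([\xi,X],Y)-\widetilde{\mathrm{Ric}}^0(X,[\xi,Y]).$$ A left-invariant Ricci collineation associated to $\nabla^0$ is a left-invariant $\xi$ with $L_\xi\widetilde{\mathrm{Ric}}^0=0$. The group admits left-invariant Ricci collineations if there is a nonzero such $\xi$. *)

theory Defs
  imports "HOL-Analysis.Analysis" "HOL-Library.Function_Algebras"
begin

section \<open>Smooth manifolds and Lie groups\<close>

primrec Ck_on :: "nat \<Rightarrow> ('a::euclidean_space \<Rightarrow> 'b::euclidean_space) \<Rightarrow> 'a set \<Rightarrow> bool" where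
  "Ck_on 0 f S \<longleftrightarrow> continuous_on S f"
| "Ck_on (Suc k) f S \<longleftrightarrow>
     (\<forall>x\<in>S. f differentiable (at x)) \<and> (\<forall>v. Ck_on k (\<lambda>x. frechet_derivative f (at x) v) S)"

text \<open>The following is only meaningful, and only used, for open \<open>S\<close>.\<close>

definition smooth_on :: "('a::euclidean_space \<Rightarrow> 'b::euclidean_space) \<Rightarrow> 'a set \<Rightarrow> bool" where
  "smooth_on f S \<longleftrightarrow> (\<forall>k. Ck_on k f S)"

type_synonym ('m, 'e) chart = "'m set \<times> ('m \<Rightarrow> 'e)"
type_synonym ('m, 'e) atlas = "('m, 'e) chart set"

text \<open>The manifold is the whole type \<open>'m\<close>; atlases are not required to be maximal.\<close>

definition smooth_atlas ::
    "('m::{t2_space, second_countable_topology}, 'e::euclidean_space) atlas \<Rightarrow> bool" where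
  "smooth_atlas A \<longleftrightarrow>
     (\<Union>(U, \<phi>)\<in>A. U) = UNIV \<and>
     (\<forall>(U, \<phi>)\<in>A. open U \<and> open (\<phi> ` U) \<and> homeomorphism U (\<phi> ` U) \<phi> (inv_into U \<phi>)) \<and>
     (\<forall>(U, \<phi>)\<in>A. \<forall>(V, \<psi>)\<in>A. smooth_on (\<psi> \<circ> inv_into U \<phi>) (\<phi> ` (U \<inter> V)))"

definition smooth_map ::
    "('m::topological_space, 'e::euclidean_space) atlas \<Rightarrow>
     ('n::topological_space, 'f::euclidean_space) atlas \<Rightarrow> ('m \<Rightarrow> 'n) \<Rightarrow> bool" where
  "smooth_map A B F \<longleftrightarrow>
     continuous_on UNIV F \<and>
     (\<forall>(U, \<phi>)\<in>A. \<forall>(V, \<psi>)\<in>B. smooth_on (\<psi> \<circ> F \<circ> inv_into U \<phi>) (\<phi> ` (U \<inter> F -` V)))"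

definition prod_atlas :: "('m, 'e) atlas \<Rightarrow> ('n, 'f) atlas \<Rightarrow> ('m \<times> 'n, 'e \<times> 'f) atlas" where
  "prod_atlas A B = {(U \<times> V, map_prod \<phi> \<psi>) | U \<phi> V \<psi>. (U, \<phi>) \<in> A \<and> (V, \<psi>) \<in> B}"

definition smooth_functions ::
    "('m::topological_space, 'e::euclidean_space) atlas \<Rightarrow> ('m \<Rightarrow> real) set" where
  "smooth_functions A = {f. smooth_map A {(UNIV, \<lambda>t::real. t)} f}"

definition lie_group ::
    "('g::{t2_space, second_countable_topology}, 'e::euclidean_space) atlas \<Rightarrow>
     ('g \<Rightarrow> 'g \<Rightarrow> 'g) \<Rightarrow> 'g \<Rightarrow> ('g \<Rightarrow> 'g) \<Rightarrow> bool" where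
  "lie_group A mul one ginv \<longleftrightarrow>
     group mul one ginv \<and> smooth_atlas A \<and>
     smooth_map (prod_atlas A A) A (\<lambda>(x, y). mul x y) \<and> smooth_map A A ginv"

text \<open>Unimodularity: some Haar measure is both left and right invariant. Regularity is automatic,
  since the spaces in question are locally compact and second countable.\<close>

definition unimodular :: "('g::topological_space \<Rightarrow> 'g \<Rightarrow> 'g) \<Rightarrow> bool" where
  "unimodular mul \<longleftrightarrow>
     (\<exists>\<mu>. sets \<mu> = sets borel \<and> emeasure \<mu> UNIV \<noteq> 0 \<and>
        (\<forall>K. compact K \<longrightarrow> emeasure \<mu> K < \<infinity>) \<and>
        (\<forall>a. distr \<mu> borel (mul a) = \<mu>) \<and> (\<forall>a. distr \<mu> borel (\<lambda>x. mul x a) = \<mu>))"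

section \<open>Vector fields\<close>

text \<open>A tangent vector at \<open>p\<close> is represented by its action on smooth functions: in a chart it is the
  directional derivative along a coordinate vector \<open>c\<close>. So that equality of tangent vectors is
  equality of their actions on smooth functions, the value on non-smooth functions is set to 0.
  Sums, differences and 0 of tangent vectors and vector fields are those of function spaces.\<close>

type_synonym 'm tvec = "('m \<Rightarrow> real) \<Rightarrow> real"
type_synonym 'm vfield = "'m \<Rightarrow> 'm tvec"

definition tangent_space ::
    "('m::topological_space, 'e::euclidean_space) atlas \<Rightarrow> 'm \<Rightarrow> 'm tvec set" where
  "tangent_space A p =
     {v. (\<forall>f. f \<notin> smooth_functions A \<longrightarrow> v f = 0) \<and>
         (\<forall>(U, \<phi>)\<in>A. p \<in> U \<longrightarrow>
            (\<exists>c. \<forall>f\<in>smooth_functions A.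
               v f = frechet_derivative (f \<circ> inv_into U \<phi>) (at (\<phi> p)) c))}"

definition tscale :: "real \<Rightarrow> 'm tvec \<Rightarrow> 'm tvec" (infixr "*\<^sub>T" 75) where
  "a *\<^sub>T v = (\<lambda>f. a * v f)"

definition pushforward :: "('m \<Rightarrow> 'n) \<Rightarrow> 'm tvec \<Rightarrow> 'n tvec" where
  "pushforward F v = (\<lambda>f. v (f \<circ> F))"

definition deriv_along :: "'m vfield \<Rightarrow> ('m \<Rightarrow> real) \<Rightarrow> ('m \<Rightarrow> real)" where
  "deriv_along X f = (\<lambda>p. X p f)"

definition vector_fields ::
    "('m::topological_space, 'e::euclidean_space) atlas \<Rightarrow> 'm vfield set" where
  "vector_fields A =
     {X. (\<forall>p. X p \<in> tangent_space A p) \<and>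
         (\<forall>f\<in>smooth_functions A. deriv_along X f \<in> smooth_functions A)}"

definition fscale :: "('m \<Rightarrow> real) \<Rightarrow> 'm vfield \<Rightarrow> 'm vfield" (infixr "*\<^sub>F" 75) where
  "h *\<^sub>F X = (\<lambda>p. h p *\<^sub>T X p)"

abbreviation cscale :: "real \<Rightarrow> 'm vfield \<Rightarrow> 'm vfield" (infixr "*\<^sub>C" 75) where
  "c *\<^sub>C X \<equiv> (\<lambda>_. c) *\<^sub>F X"

definition lie_bracket :: "'m vfield \<Rightarrow> 'm vfield \<Rightarrow> 'm vfield" where
  "lie_bracket X Y = (\<lambda>p f. X p (deriv_along Y f) - Y p (deriv_along X f))"

definition left_invariant_fields ::
    "('g::topological_space, 'e::euclidean_space) atlas \<Rightarrow> ('g \<Rightarrow> 'g \<Rightarrow> 'g) \<Rightarrow> 'g vfield set" where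
  "left_invariant_fields A mul =
     {X \<in> vector_fields A. \<forall>a p. X (mul a p) = pushforward (mul a) (X p)}"

definition lie_algebra_basis ::
    "('g::topological_space, real^3) atlas \<Rightarrow> ('g \<Rightarrow> 'g \<Rightarrow> 'g) \<Rightarrow>
     'g vfield \<Rightarrow> 'g vfield \<Rightarrow> 'g vfield \<Rightarrow> bool" where
  "lie_algebra_basis A mul e1 e2 e3 \<longleftrightarrow>
     {e1, e2, e3} \<subseteq> left_invariant_fields A mul \<and>
     (\<forall>X\<in>left_invariant_fields A mul. \<exists>c1 c2 c3. X = c1 *\<^sub>C e1 + c2 *\<^sub>C e2 + c3 *\<^sub>C e3) \<and>
     (\<forall>c1 c2 c3. c1 *\<^sub>C e1 + c2 *\<^sub>C e2 + c3 *\<^sub>C e3 = 0 \<longrightarrow> c1 = 0 \<and> c2 = 0 \<and> c3 = 0)"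

section \<open>Metrics, (1,1)-tensors and connections\<close>

type_synonym 'm form2 = "'m \<Rightarrow> 'm tvec \<Rightarrow> 'm tvec \<Rightarrow> real"
type_synonym 'm endo = "'m \<Rightarrow> 'm tvec \<Rightarrow> 'm tvec"
type_synonym 'm connection = "'m vfield \<Rightarrow> 'm vfield \<Rightarrow> 'm vfield"

definition form_app :: "'m form2 \<Rightarrow> 'm vfield \<Rightarrow> 'm vfield \<Rightarrow> ('m \<Rightarrow> real)" where
  "form_app g X Y = (\<lambda>p. g p (X p) (Y p))"

definition endo_app :: "'m endo \<Rightarrow> 'm vfield \<Rightarrow> 'm vfield" where
  "endo_app J X = (\<lambda>p. J p (X p))"

text \<open>Three-dimensional Lorentzian metrics, of signature \<open>(+,+,-)\<close>.\<close>

definition lorentzian_metric :: "('m::topological_space, real^3) atlas \<Rightarrow> 'm form2 \<Rightarrow> bool" where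
  "lorentzian_metric A g \<longleftrightarrow>
     (\<forall>p. \<forall>u\<in>tangent_space A p. \<forall>v\<in>tangent_space A p. g p u v = g p v u) \<and>
     (\<forall>p. \<forall>u\<in>tangent_space A p. \<forall>v\<in>tangent_space A p. \<forall>w\<in>tangent_space A p. \<forall>a b.
        g p (a *\<^sub>T u + b *\<^sub>T v) w = a * g p u w + b * g p v w) \<and>
     (\<forall>p. \<exists>v1\<in>tangent_space A p. \<exists>v2\<in>tangent_space A p. \<exists>v3\<in>tangent_space A p.
        (\<forall>w\<in>tangent_space A p. \<exists>a b c. w = a *\<^sub>T v1 + b *\<^sub>T v2 + c *\<^sub>T v3) \<and>
        g p v1 v1 = 1 \<and> g p v2 v2 = 1 \<and> g p v3 v3 = -1 \<and>
        g p v1 v2 = 0 \<and> g p v1 v3 = 0 \<and> g p v2 v3 = 0) \<and>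
     (\<forall>X\<in>vector_fields A. \<forall>Y\<in>vector_fields A. form_app g X Y \<in> smooth_functions A)"

definition left_invariant_form ::
    "('g::topological_space, 'e::euclidean_space) atlas \<Rightarrow> ('g \<Rightarrow> 'g \<Rightarrow> 'g) \<Rightarrow> 'g form2 \<Rightarrow> bool" where
  "left_invariant_form A mul g \<longleftrightarrow>
     (\<forall>a p. \<forall>u\<in>tangent_space A p. \<forall>v\<in>tangent_space A p.
        g (mul a p) (pushforward (mul a) u) (pushforward (mul a) v) = g p u v)"

definition product_structure ::
    "('m::topological_space, 'e::euclidean_space) atlas \<Rightarrow> 'm endo \<Rightarrow> bool" where
  "product_structure A J \<longleftrightarrow>
     (\<forall>p. \<forall>v\<in>tangent_space A p. J p v \<in> tangent_space A p \<and> J p (J p v) = v) \<and>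
     (\<forall>p. \<forall>u\<in>tangent_space A p. \<forall>v\<in>tangent_space A p. \<forall>a b.
        J p (a *\<^sub>T u + b *\<^sub>T v) = a *\<^sub>T J p u + b *\<^sub>T J p v) \<and>
     (\<forall>X\<in>vector_fields A. endo_app J X \<in> vector_fields A)"

definition left_invariant_endo ::
    "('g::topological_space, 'e::euclidean_space) atlas \<Rightarrow> ('g \<Rightarrow> 'g \<Rightarrow> 'g) \<Rightarrow> 'g endo \<Rightarrow> bool" where
  "left_invariant_endo A mul J \<longleftrightarrow>
     (\<forall>a p. \<forall>v\<in>tangent_space A p.
        J (mul a p) (pushforward (mul a) v) = pushforward (mul a) (J p v))"

definition pseudo_orthonormal ::
    "'m form2 \<Rightarrow> 'm vfield \<Rightarrow> 'm vfield \<Rightarrow> 'm vfield \<Rightarrow> bool" where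
  "pseudo_orthonormal g e1 e2 e3 \<longleftrightarrow>
     form_app g e1 e1 = 1 \<and> form_app g e2 e2 = 1 \<and> form_app g e3 e3 = -1 \<and>
     form_app g e1 e2 = 0 \<and> form_app g e2 e1 = 0 \<and>
     form_app g e1 e3 = 0 \<and> form_app g e3 e1 = 0 \<and>
     form_app g e2 e3 = 0 \<and> form_app g e3 e2 = 0"

definition affine_connection ::
    "('m::topological_space, 'e::euclidean_space) atlas \<Rightarrow> 'm connection \<Rightarrow> bool" where
  "affine_connection A D \<longleftrightarrow>
     (\<forall>X\<in>vector_fields A. \<forall>Y\<in>vector_fields A. D X Y \<in> vector_fields A) \<and>
     (\<forall>X\<in>vector_fields A. \<forall>Y\<in>vector_fields A. \<forall>Z\<in>vector_fields A.
        D (X + Y) Z = D X Z + D Y Z \<and> D X (Y + Z) = D X Y + D X Z) \<and>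
     (\<forall>h\<in>smooth_functions A. \<forall>X\<in>vector_fields A. \<forall>Y\<in>vector_fields A.
        D (h *\<^sub>F X) Y = h *\<^sub>F D X Y \<and>
        D X (h *\<^sub>F Y) = deriv_along X h *\<^sub>F Y + h *\<^sub>F D X Y)"

definition levi_civita ::
    "('m::topological_space, 'e::euclidean_space) atlas \<Rightarrow> 'm form2 \<Rightarrow> 'm connection \<Rightarrow> bool" where
  "levi_civita A g D \<longleftrightarrow>
     affine_connection A D \<and>
     (\<forall>X\<in>vector_fields A. \<forall>Y\<in>vector_fields A. D X Y - D Y X = lie_bracket X Y) \<and>
     (\<forall>X\<in>vector_fields A. \<forall>Y\<in>vector_fields A. \<forall>Z\<in>vector_fields A.
        deriv_along X (form_app g Y Z) = form_app g (D X Y) Z + form_app g Y (D X Z))"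

definition cov_deriv_endo :: "'m connection \<Rightarrow> 'm endo \<Rightarrow> 'm vfield \<Rightarrow> 'm vfield \<Rightarrow> 'm vfield" where
  "cov_deriv_endo D J X Y = D X (endo_app J Y) - endo_app J (D X Y)"

definition canonical_connection :: "'m connection \<Rightarrow> 'm endo \<Rightarrow> 'm connection" where
  "canonical_connection D J X Y = D X Y - (1/2) *\<^sub>C cov_deriv_endo D J X (endo_app J Y)"

definition curvature ::
    "'m connection \<Rightarrow> 'm vfield \<Rightarrow> 'm vfield \<Rightarrow> 'm vfield \<Rightarrow> 'm vfield" where
  "curvature D X Y Z = D X (D Y Z) - D Y (D X Z) - D (lie_bracket X Y) Z"

section \<open>Ricci collineations\<close>

definition ricci ::
    "'m form2 \<Rightarrow> 'm connection \<Rightarrow> 'm vfield \<Rightarrow> 'm vfield \<Rightarrow> 'm vfield \<Rightarrow>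
     'm vfield \<Rightarrow> 'm vfield \<Rightarrow> ('m \<Rightarrow> real)" where
  "ricci g D e1 e2 e3 X Y =
     - form_app g (curvature D X e1 Y) e1 - form_app g (curvature D X e2 Y) e2
     + form_app g (curvature D X e3 Y) e3"

definition sym_ricci ::
    "'m form2 \<Rightarrow> 'm connection \<Rightarrow> 'm vfield \<Rightarrow> 'm vfield \<Rightarrow> 'm vfield \<Rightarrow>
     'm vfield \<Rightarrow> 'm vfield \<Rightarrow> ('m \<Rightarrow> real)" where
  "sym_ricci g D e1 e2 e3 X Y =
     (\<lambda>p. 1/2 * (ricci g D e1 e2 e3 X Y p + ricci g D e1 e2 e3 Y X p))"

definition lie_derivative2 ::
    "'m vfield \<Rightarrow> ('m vfield \<Rightarrow> 'm vfield \<Rightarrow> ('m \<Rightarrow> real)) \<Rightarrow>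
     'm vfield \<Rightarrow> 'm vfield \<Rightarrow> ('m \<Rightarrow> real)" where
  "lie_derivative2 \<xi> S X Y =
     deriv_along \<xi> (S X Y) - S (lie_bracket \<xi> X) Y - S X (lie_bracket \<xi> Y)"

definition left_invariant_ricci_collineation ::
    "('g::topological_space, 'e::euclidean_space) atlas \<Rightarrow> ('g \<Rightarrow> 'g \<Rightarrow> 'g) \<Rightarrow> 'g form2 \<Rightarrow>
     'g connection \<Rightarrow> 'g vfield \<Rightarrow> 'g vfield \<Rightarrow> 'g vfield \<Rightarrow> 'g vfield \<Rightarrow> bool" where
  "left_invariant_ricci_collineation A mul g D e1 e2 e3 \<xi> \<longleftrightarrow>
     \<xi> \<in> left_invariant_fields A mul \<and>
     (\<forall>X\<in>vector_fields A. \<forall>Y\<in>vector_fields A.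
        lie_derivative2 \<xi> (sym_ricci g D e1 e2 e3) X Y = 0)"

definition admits_left_invariant_ricci_collineations ::
    "('g::topological_space, 'e::euclidean_space) atlas \<Rightarrow> ('g \<Rightarrow> 'g \<Rightarrow> 'g) \<Rightarrow> 'g form2 \<Rightarrow>
     'g connection \<Rightarrow> 'g vfield \<Rightarrow> 'g vfield \<Rightarrow> 'g vfield \<Rightarrow> bool" where
  "admits_left_invariant_ricci_collineations A mul g D e1 e2 e3 \<longleftrightarrow>
     (\<exists>\<xi>. \<xi> \<noteq> 0 \<and> left_invariant_ricci_collineation A mul g D e1 e2 e3 \<xi>)"

end

theory Submission
  imports Defs
begin

text \<open>On constant-coefficient combinations of the frame all quantities involved have constant
  coefficients. Koszul's formula determines the Levi-Civita connection, and the canonical connection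
  becomes \<open>\<nabla>\<^sup>0\<^sub>X Y = \<omega>(X) (y\<^sub>2 e\<^sub>1 - y\<^sub>1 e\<^sub>2)\<close> with \<open>\<omega>(X) = \<alpha> x\<^sub>1 - \<beta> x\<^sub>3 / 2\<close>, whence
  \<open>R\<^sup>0(X,Y) Z = - \<omega>([X,Y]) (z\<^sub>2 e\<^sub>1 - z\<^sub>1 e\<^sub>2)\<close>. For \<open>\<xi> = (x, y, z)\<close>, the three diagonal entries of
  \<open>L\<^sub>\<xi> Ric\<close> give \<open>P(\<alpha>, \<beta>) z = 0\<close> with \<open>P\<close> positive for \<open>\<alpha> \<noteq> 0\<close>; then \<open>y = 0\<close>, and the
  \<open>(1,2)\<close> entry gives \<open>x = 0\<close>.\<close>

section \<open>Constant linear combinations of smooth objects\<close>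

lemma has_derivative_frechet_derivative:
  "f differentiable at x \<Longrightarrow> (f has_derivative frechet_derivative f (at x)) (at x)"
  by (simp add: frechet_derivative_works)

lemma frechet_derivative_const_at: "frechet_derivative (\<lambda>x. c) (at x) = (\<lambda>h. 0)"
  using frechet_derivative_at[OF has_derivative_const] by metis

lemma frechet_derivative_lincomb:
  fixes f g :: "'a::real_normed_vector \<Rightarrow> 'b::real_normed_vector"
  assumes "f differentiable at x" "g differentiable at x"
  shows "frechet_derivative (\<lambda>x. a *\<^sub>R f x + b *\<^sub>R g x) (at x) v =
    a *\<^sub>R frechet_derivative f (at x) v + b *\<^sub>R frechet_derivative g (at x) v"
proof -
  have "((\<lambda>x. a *\<^sub>R f x + b *\<^sub>R g x) has_derivative
    (\<lambda>v. a *\<^sub>R frechet_derivative f (at x) v + b *\<^sub>R frechet_derivative g (at x) v)) (at x)"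
    by (intro derivative_intros has_derivative_frechet_derivative assms)
  from frechet_derivative_at[OF this] show ?thesis by metis
qed

text \<open>\<open>frechet_derivative\<close> is a choice among all derivatives at \<open>x\<close>,
  so it is enough that \<open>f\<close> and \<open>g\<close> have the same ones. Agreement near
  \<open>x\<close> ensures this even where neither is differentiable.\<close>

lemma frechet_derivative_cong_open:
  assumes "open S" "x \<in> S" "\<And>y. y \<in> S \<Longrightarrow> f y = g y"
  shows "frechet_derivative f (at x) = frechet_derivative g (at x)"
proof -
  have "(f has_derivative f') (at x) \<longleftrightarrow> (g has_derivative f') (at x)" for f'
    using assms has_derivative_transform_within_open[of f f' x UNIV S g]
      has_derivative_transform_within_open[of g f' x UNIV S f] by auto
  then show ?thesis by (simp add: frechet_derivative_def)
qed

lemma differentiable_cong_open: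
  assumes "open S" "x \<in> S" "\<And>y. y \<in> S \<Longrightarrow> f y = g y" "f differentiable at x"
  shows "g differentiable at x"
  using assms has_derivative_transform_within_open[of f _ x UNIV S g]
  by (auto simp: differentiable_def)

text \<open>Each recursion step of \<open>Ck_on\<close> replaces the function by its derivatives, so
  the induction generalises over \<open>f\<close> and \<open>g\<close>. Openness of \<open>S\<close>
  makes these derivatives depend only on values in \<open>S\<close>.\<close>

lemma Ck_on_cong:
  assumes "open S"
  shows "(\<And>y. y \<in> S \<Longrightarrow> f y = g y) \<Longrightarrow> Ck_on k f S \<Longrightarrow> Ck_on k g S"
proof (induction k arbitrary: f g)
  case 0
  then show ?case by (simp cong: continuous_on_cong)
next
  case (Suc k)
  have "Ck_on k (\<lambda>x. frechet_derivative g (at x) v) S" for v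
  proof (rule Suc.IH)
    show "Ck_on k (\<lambda>x. frechet_derivative f (at x) v) S" using Suc.prems by simp
    show "\<And>y. y \<in> S \<Longrightarrow> frechet_derivative f (at y) v = frechet_derivative g (at y) v"
      using frechet_derivative_cong_open[OF assms] Suc.prems(1) by metis
  qed
  then show ?case
    using Suc.prems differentiable_cong_open[OF assms _ Suc.prems(1)] by auto
qed

lemma Ck_on_const: "Ck_on k (\<lambda>x. c) S"
  by (induction k arbitrary: c) (simp_all add: frechet_derivative_const_at)

lemma Ck_on_lincomb:
  assumes "open S"
  shows "Ck_on k f S \<Longrightarrow> Ck_on k g S \<Longrightarrow> Ck_on k (\<lambda>x. a *\<^sub>R f x + b *\<^sub>R g x) S"
proof (induction k arbitrary: f g)
  case 0
  then show ?case by (auto intro!: continuous_intros)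
next
  case (Suc k)
  have "Ck_on k (\<lambda>x. frechet_derivative (\<lambda>x. a *\<^sub>R f x + b *\<^sub>R g x) (at x) v) S" for v
  \<comment> \<open>Differentiability is known only at points of \<open>S\<close>, so the formula
    for the derivative of the combination is an equality on \<open>S\<close> rather than of
    functions.\<close>
  proof (rule Ck_on_cong[OF assms])
    show "Ck_on k (\<lambda>x. a *\<^sub>R frechet_derivative f (at x) v
        + b *\<^sub>R frechet_derivative g (at x) v) S"
      using Suc by simp
  qed (use Suc.prems in \<open>simp add: frechet_derivative_lincomb\<close>)
  then show ?case using Suc.prems by auto
qed

lemma smooth_functions_iff:
  "f \<in> smooth_functions A \<longleftrightarrow>
     continuous_on UNIV f \<and> (\<forall>(U, \<phi>)\<in>A. smooth_on (f \<circ> inv_into U \<phi>) (\<phi> ` U))"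
  by (auto simp: smooth_functions_def smooth_map_def comp_def)

lemma smooth_functions_Ck_on:
  "f \<in> smooth_functions A \<Longrightarrow> (U, \<phi>) \<in> A \<Longrightarrow> Ck_on k (f \<circ> inv_into U \<phi>) (\<phi> ` U)"
  unfolding smooth_functions_iff smooth_on_def by blast

lemma smooth_functions_const: "(\<lambda>_. c) \<in> smooth_functions A"
  by (auto simp: smooth_functions_iff smooth_on_def comp_def Ck_on_const)

lemma smooth_functions_lincomb:
  assumes "smooth_atlas A" "f \<in> smooth_functions A" "h \<in> smooth_functions A"
  shows "(\<lambda>p. a * f p + b * h p) \<in> smooth_functions A"
proof -
  have "smooth_on ((\<lambda>p. a * f p + b * h p) \<circ> inv_into U \<phi>) (\<phi> ` U)" if "(U, \<phi>) \<in> A" for U \<phi>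
  proof -
    have "open (\<phi> ` U)" using assms(1) that by (auto simp: smooth_atlas_def)
    then show ?thesis
      using Ck_on_lincomb[OF _ smooth_functions_Ck_on[OF assms(2) that]
          smooth_functions_Ck_on[OF assms(3) that], of _ a b]
      by (simp add: smooth_on_def comp_def)
  qed
  moreover have "continuous_on UNIV (\<lambda>p. a * f p + b * h p)"
    using assms by (auto simp: smooth_functions_iff intro!: continuous_intros)
  ultimately show ?thesis by (auto simp: smooth_functions_iff)
qed

lemma smooth_functions_differentiable:
  assumes "f \<in> smooth_functions A" "(U, \<phi>) \<in> A" "p \<in> U"
  shows "(f \<circ> inv_into U \<phi>) differentiable at (\<phi> p)"
  using smooth_functions_Ck_on[OF assms(1,2), of "Suc 0"] assms(3) by simp

lemma smooth_atlas_chart: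
  assumes "smooth_atlas A"
  obtains U \<phi> where "(U, \<phi>) \<in> A" "p \<in> U"
  using assms UNIV_I[of p] unfolding smooth_atlas_def by blast

section \<open>Tangent vectors and vector fields\<close>

lemma tangent_space_lincomb:
  assumes u: "u \<in> tangent_space A p" and w: "w \<in> tangent_space A p"
  shows "a *\<^sub>T u + b *\<^sub>T w \<in> tangent_space A p"
proof -
  have "\<exists>c. \<forall>f\<in>smooth_functions A. (a *\<^sub>T u + b *\<^sub>T w) f =
      frechet_derivative (f \<circ> inv_into U \<phi>) (at (\<phi> p)) c" if U: "(U, \<phi>) \<in> A" "p \<in> U" for U \<phi>
  proof -
    obtain c where c: "\<And>f. f \<in> smooth_functions A \<Longrightarrow>
        u f = frechet_derivative (f \<circ> inv_into U \<phi>) (at (\<phi> p)) c"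
      using u U unfolding tangent_space_def by blast
    obtain d where d: "\<And>f. f \<in> smooth_functions A \<Longrightarrow>
        w f = frechet_derivative (f \<circ> inv_into U \<phi>) (at (\<phi> p)) d"
      using w U unfolding tangent_space_def by blast
    have "(a *\<^sub>T u + b *\<^sub>T w) f =
        frechet_derivative (f \<circ> inv_into U \<phi>) (at (\<phi> p)) (a *\<^sub>R c + b *\<^sub>R d)"
      if f: "f \<in> smooth_functions A" for f
    proof -
      have "linear (frechet_derivative (f \<circ> inv_into U \<phi>) (at (\<phi> p)))"
        using smooth_functions_differentiable[OF f U] linear_frechet_derivative by blast
      then show ?thesis
        by (simp add: linear_add linear_cmul c[OF f] d[OF f] tscale_def)
    qed
    then show ?thesis by blast
  qed
  then show ?thesis
    using u w by (auto simp: tangent_space_def tscale_def)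
qed

text \<open>A constant is constant in every chart, so its derivative vanishes. This later removes
  every derivative term from computations with constant coefficients.\<close>

lemma tangent_space_const:
  assumes "smooth_atlas A" "v \<in> tangent_space A p"
  shows "v (\<lambda>_. c) = 0"
proof -
  obtain U \<phi> where U: "(U, \<phi>) \<in> A" "p \<in> U" using smooth_atlas_chart[OF assms(1)] .
  then obtain d where "\<And>f. f \<in> smooth_functions A \<Longrightarrow>
      v f = frechet_derivative (f \<circ> inv_into U \<phi>) (at (\<phi> p)) d"
    using assms(2) unfolding tangent_space_def by blast
  then show ?thesis
    using smooth_functions_const[of c A] by (simp add: comp_def frechet_derivative_const_at)
qed

lemma one_tscale: "1 *\<^sub>T v = v"
  by (simp add: tscale_def)

lemma fscale_apply: "(h *\<^sub>F X) p = h p *\<^sub>T X p"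
  by (simp add: fscale_def)

lemma vector_fields_lincomb:
  assumes "smooth_atlas A" "X \<in> vector_fields A" "Y \<in> vector_fields A"
  shows "a *\<^sub>C X + b *\<^sub>C Y \<in> vector_fields A"
proof -
  have "deriv_along (a *\<^sub>C X + b *\<^sub>C Y) f \<in> smooth_functions A"
    if "f \<in> smooth_functions A" for f
    using smooth_functions_lincomb[OF assms(1), of "deriv_along X f" "deriv_along Y f" a b] assms that
    by (auto simp: deriv_along_def vector_fields_def fscale_def tscale_def)
  moreover have "(a *\<^sub>C X + b *\<^sub>C Y) p \<in> tangent_space A p" for p
    using assms tangent_space_lincomb[of "X p" A p "Y p" a b]
    by (simp add: vector_fields_def fscale_apply)
  ultimately show ?thesis by (simp add: vector_fields_def)
qed

lemma deriv_along_const: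
  assumes "smooth_atlas A" "X \<in> vector_fields A"
  shows "deriv_along X (\<lambda>_. c) = (\<lambda>_. 0)"
  using assms(2) tangent_space_const[OF assms(1), of "X p" p c for p]
  by (simp add: deriv_along_def vector_fields_def)

section \<open>Lorentzian frames\<close>

locale lorentz_frame =
  fixes A :: "('m::{t2_space, second_countable_topology}, real^3) atlas"
    and g :: "'m form2" and e1 e2 e3 :: "'m vfield"
  assumes atlas: "smooth_atlas A" and metric: "lorentzian_metric A g"
    and e_in: "e1 \<in> vector_fields A" "e2 \<in> vector_fields A" "e3 \<in> vector_fields A"
    and orthonormal: "pseudo_orthonormal g e1 e2 e3"
begin

text \<open>Constant coefficients suffice: a basis of the Lie algebra writes each left-invariant
  field this way, and in \<open>G1_frame\<close> the connections, the bracket and \<open>J\<close>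
  preserve the form. Identities of fields thus reduce to arithmetic of coefficients.\<close>

definition frame :: "real \<Rightarrow> real \<Rightarrow> real \<Rightarrow> 'm vfield" where
  "frame a b c = a *\<^sub>C e1 + b *\<^sub>C e2 + c *\<^sub>C e3"

lemma frame_apply: "frame a b c p f = a * e1 p f + b * e2 p f + c * e3 p f"
  by (simp add: frame_def fscale_def tscale_def)

lemma frame_arith:
  "frame a b c + frame x y z = frame (a + x) (b + y) (c + z)"
  "frame a b c - frame x y z = frame (a - x) (b - y) (c - z)"
  "- frame a b c = frame (- a) (- b) (- c)"
  "k *\<^sub>C frame a b c = frame (k * a) (k * b) (k * c)"
  by (auto simp: fun_eq_iff frame_apply fscale_def tscale_def algebra_simps)

lemma e_eq_frame: "e1 = frame 1 0 0" "e2 = frame 0 1 0" "e3 = frame 0 0 1"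
  by (auto simp: fun_eq_iff frame_apply)

lemma frame_zero: "frame 0 0 0 = 0"
  by (auto simp: fun_eq_iff frame_apply)

lemma frame_in: "frame a b c \<in> vector_fields A"
proof -
  have "1 *\<^sub>C (a *\<^sub>C e1 + b *\<^sub>C e2) + c *\<^sub>C e3 \<in> vector_fields A"
    by (intro vector_fields_lincomb atlas e_in)
  moreover have "1 *\<^sub>C (a *\<^sub>C e1 + b *\<^sub>C e2) + c *\<^sub>C e3 = frame a b c"
    by (auto simp: fun_eq_iff frame_apply fscale_def tscale_def)
  ultimately show ?thesis by simp
qed

lemma vfield_in_tangent: "X \<in> vector_fields A \<Longrightarrow> X p \<in> tangent_space A p"
  by (simp add: vector_fields_def)

lemma metric_sym: "u \<in> tangent_space A p \<Longrightarrow> v \<in> tangent_space A p \<Longrightarrow> g p u v = g p v u"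
  using metric unfolding lorentzian_metric_def by blast

lemma metric_lincomb:
  assumes "u \<in> tangent_space A p" "v \<in> tangent_space A p" "w \<in> tangent_space A p"
  shows "g p (a *\<^sub>T u + b *\<^sub>T v) w = a * g p u w + b * g p v w"
  using metric assms unfolding lorentzian_metric_def by blast

lemma tangent_space_lincomb3:
  assumes "u \<in> tangent_space A p" "v \<in> tangent_space A p" "w \<in> tangent_space A p"
  shows "a *\<^sub>T u + b *\<^sub>T v + c *\<^sub>T w \<in> tangent_space A p"
proof -
  have "1 *\<^sub>T (a *\<^sub>T u + b *\<^sub>T v) + c *\<^sub>T w \<in> tangent_space A p"
    using assms by (intro tangent_space_lincomb)
  then show ?thesis by (simp add: one_tscale)
qed

lemma metric_lincomb3:
  assumes "u \<in> tangent_space A p" "v \<in> tangent_space A p" "w \<in> tangent_space A p"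
    "x \<in> tangent_space A p"
  shows "g p (a *\<^sub>T u + b *\<^sub>T v + c *\<^sub>T w) x = a * g p u x + b * g p v x + c * g p w x"
proof -
  have "g p (1 *\<^sub>T (a *\<^sub>T u + b *\<^sub>T v) + c *\<^sub>T w) x = 1 * g p (a *\<^sub>T u + b *\<^sub>T v) x + c * g p w x"
    using assms by (intro metric_lincomb tangent_space_lincomb)
  then show ?thesis using assms by (simp add: metric_lincomb one_tscale)
qed

lemma form_app_sym:
  "X \<in> vector_fields A \<Longrightarrow> Y \<in> vector_fields A \<Longrightarrow> form_app g X Y = form_app g Y X"
  by (auto simp: form_app_def fun_eq_iff intro!: metric_sym vfield_in_tangent)

lemma form_app_diff:
  assumes "X \<in> vector_fields A" "Y \<in> vector_fields A" "Z \<in> vector_fields A"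
  shows "form_app g (X - Y) Z = form_app g X Z - form_app g Y Z"
proof -
  have "g p (X p - Y p) (Z p) = g p (X p) (Z p) - g p (Y p) (Z p)" for p
  proof -
    have "X p - Y p = 1 *\<^sub>T X p + (-1) *\<^sub>T Y p" by (auto simp: tscale_def)
    then show ?thesis
      using assms by (simp only:) (subst metric_lincomb, auto simp: vfield_in_tangent)
  qed
  then show ?thesis by (simp add: form_app_def fun_eq_iff)
qed

lemma form_app_frame_left:
  assumes "X \<in> vector_fields A"
  shows "form_app g (frame a b c) X p =
    a * form_app g e1 X p + b * form_app g e2 X p + c * form_app g e3 X p"
  using assms e_in
  by (simp add: form_app_def frame_def fscale_apply metric_lincomb3 vfield_in_tangent)

lemma form_app_e:
  "form_app g e1 e1 p = 1" "form_app g e2 e2 p = 1" "form_app g e3 e3 p = -1"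
  "form_app g e1 e2 p = 0" "form_app g e2 e1 p = 0" "form_app g e1 e3 p = 0"
  "form_app g e3 e1 p = 0" "form_app g e2 e3 p = 0" "form_app g e3 e2 p = 0"
  using orthonormal by (auto simp: pseudo_orthonormal_def)

lemma form_app_frame:
  "form_app g (frame a b c) (frame x y z) = (\<lambda>_. a * x + b * y - c * z)"
proof
  fix p
  \<comment> \<open>The metric axioms give linearity in the first argument only; symmetry carries it
    over to the second.\<close>
  have *: "form_app g ei (frame x y z) p =
      x * form_app g e1 ei p + y * form_app g e2 ei p + z * form_app g e3 ei p"
    if "ei \<in> vector_fields A" for ei
    using form_app_frame_left[OF that, of x y z p] form_app_sym[OF that frame_in, of x y z] by simp
  show "form_app g (frame a b c) (frame x y z) p = a * x + b * y - c * z"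
    by (simp add: form_app_frame_left[OF frame_in] *[OF e_in(1)] *[OF e_in(2)] *[OF e_in(3)]
        form_app_e)
qed

text \<open>The frame spans each tangent space: its matrix \<open>M\<close> in the basis provided by
  \<open>lorentzian_metric\<close> satisfies \<open>M \<eta> M\<^sup>T = \<eta>\<close>, so \<open>M\<close> is invertible and only the zero vector is
  orthogonal to the frame.\<close>

lemma nondegenerate:
  assumes w: "w \<in> tangent_space A p"
    and "g p (e1 p) w = 0" "g p (e2 p) w = 0" "g p (e3 p) w = 0"
  shows "w = 0"
proof -
  obtain v1 v2 v3 where v: "v1 \<in> tangent_space A p" "v2 \<in> tangent_space A p" "v3 \<in> tangent_space A p"
    and span: "\<And>w. w \<in> tangent_space A p \<Longrightarrow> \<exists>a b c. w = a *\<^sub>T v1 + b *\<^sub>T v2 + c *\<^sub>T v3"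
    and gv: "g p v1 v1 = 1" "g p v2 v2 = 1" "g p v3 v3 = -1"
      "g p v1 v2 = 0" "g p v1 v3 = 0" "g p v2 v3 = 0"
    using metric unfolding lorentzian_metric_def by metis
  have gv': "g p v2 v1 = 0" "g p v3 v1 = 0" "g p v3 v2 = 0"
    using gv v metric_sym by metis+
  have G: "g p (a *\<^sub>T v1 + b *\<^sub>T v2 + c *\<^sub>T v3) (x *\<^sub>T v1 + y *\<^sub>T v2 + z *\<^sub>T v3) =
      a * x + b * y - c * z" for a b c x y z
  proof -
    have "g p vi (x *\<^sub>T v1 + y *\<^sub>T v2 + z *\<^sub>T v3) = x * g p v1 vi + y * g p v2 vi + z * g p v3 vi"
      if "vi \<in> tangent_space A p" for vi
      using metric_lincomb3[OF v that] metric_sym[OF that tangent_space_lincomb3[OF v]] by metis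
    then show ?thesis
      by (simp add: metric_lincomb3 v tangent_space_lincomb3 gv gv')
  qed
  obtain a1 b1 c1 where 1: "e1 p = a1 *\<^sub>T v1 + b1 *\<^sub>T v2 + c1 *\<^sub>T v3"
    using span[OF vfield_in_tangent[OF e_in(1)]] by blast
  obtain a2 b2 c2 where 2: "e2 p = a2 *\<^sub>T v1 + b2 *\<^sub>T v2 + c2 *\<^sub>T v3"
    using span[OF vfield_in_tangent[OF e_in(2)]] by blast
  obtain a3 b3 c3 where 3: "e3 p = a3 *\<^sub>T v1 + b3 *\<^sub>T v2 + c3 *\<^sub>T v3"
    using span[OF vfield_in_tangent[OF e_in(3)]] by blast
  obtain x y z where w': "w = x *\<^sub>T v1 + y *\<^sub>T v2 + z *\<^sub>T v3"
    using span[OF w] by blast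
  define M :: "real^3^3" where "M = vector [vector [a1, b1, c1], vector [a2, b2, c2], vector [a3, b3, c3]]"
  \<comment> \<open>With \<eta> = diag(1,1,-1), \<open>N\<close> is the product of \<eta>, the
    transpose of \<open>M\<close>, and \<eta>, hence the inverse of \<open>M\<close>. The vector
    \<open>u\<close> below is \<eta> applied to the coordinates of \<open>w\<close>, so the entries
    of \<open>M *v u\<close> are the products of \<open>w\<close> with the frame.\<close>
  define N :: "real^3^3" where "N = vector [vector [a1, a2, -a3], vector [b1, b2, -b3], vector [-c1, -c2, c3]]"
  define u :: "real^3" where "u = vector [x, y, -z]"
  have "M ** N = mat 1"
    using form_app_e[of p]
    by (simp add: form_app_def 1 2 3 G M_def N_def vec_eq_iff forall_3 matrix_matrix_mult_def
        sum_3 mat_def)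
  then have "N ** M = mat 1" by (simp add: matrix_left_right_inverse)
  moreover have "M *v u = 0"
    using assms(2-4)
    by (simp add: 1 2 3 w' G M_def u_def vec_eq_iff forall_3 matrix_vector_mult_def sum_3)
  ultimately have "u = 0"
    by (metis matrix_vector_mul_assoc matrix_vector_mul_lid matrix_vector_mult_0_right)
  then have "x = 0" "y = 0" "z = 0"
    by (simp_all add: u_def vec_eq_iff forall_3)
  then show ?thesis by (auto simp: w' tscale_def)
qed

text \<open>The difference of the two sides is orthogonal to the frame, hence zero by
  \<open>nondegenerate\<close>. The sign in front of \<open>c\<close> appears because
  \<open>e3\<close> is timelike.\<close>

lemma eq_frame:
  assumes X: "X \<in> vector_fields A"
    and "form_app g X e1 = (\<lambda>_. a)" "form_app g X e2 = (\<lambda>_. b)" "form_app g X e3 = (\<lambda>_. - c)"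
  shows "X = frame a b c"
proof
  fix p
  let ?w = "X p - frame a b c p"
  have w: "?w = 1 *\<^sub>T X p + (-1) *\<^sub>T frame a b c p" by (auto simp: tscale_def)
  have wt: "?w \<in> tangent_space A p"
    unfolding w by (intro tangent_space_lincomb vfield_in_tangent X frame_in)
  have "form_app g (X - frame a b c) e p = g p (e p) ?w" if "e \<in> vector_fields A" for e
    using metric_sym[OF wt vfield_in_tangent[OF that]] by (simp add: form_app_def)
  moreover have "form_app g (X - frame a b c) e1 p = 0" "form_app g (X - frame a b c) e2 p = 0"
    "form_app g (X - frame a b c) e3 p = 0"
    by (simp_all add: form_app_diff X frame_in e_in assms form_app_frame_left form_app_e)
  ultimately have "?w = 0" using nondegenerate[OF wt] e_in by simp
  then show "X p = frame a b c p" by simp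
qed

end

section \<open>The Levi-Civita connection of a frame\<close>

locale levi_civita_frame = lorentz_frame A g e1 e2 e3
  for A :: "('m::{t2_space, second_countable_topology}, real^3) atlas"
    and g and e1 e2 e3 :: "'m vfield" +
  fixes D :: "'m connection"
  assumes levi_civita: "levi_civita A g D"
begin

lemma connection: "affine_connection A D"
  using levi_civita by (simp add: levi_civita_def)

lemma cscale_in: "X \<in> vector_fields A \<Longrightarrow> c *\<^sub>C X \<in> vector_fields A"
  using vector_fields_lincomb[OF atlas, of X X c 0]
  by (simp add: fscale_def tscale_def plus_fun_def)

lemma add_in: "X \<in> vector_fields A \<Longrightarrow> Y \<in> vector_fields A \<Longrightarrow> X + Y \<in> vector_fields A"
  using vector_fields_lincomb[OF atlas, of X Y 1 1]
  by (simp add: fscale_def tscale_def plus_fun_def)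

lemma D_in: "X \<in> vector_fields A \<Longrightarrow> Y \<in> vector_fields A \<Longrightarrow> D X Y \<in> vector_fields A"
  using connection by (simp add: affine_connection_def)

lemma D_add:
  assumes "X \<in> vector_fields A" "Y \<in> vector_fields A" "Z \<in> vector_fields A"
  shows "D (X + Y) Z = D X Z + D Y Z" "D X (Y + Z) = D X Y + D X Z"
  using connection assms by (simp_all add: affine_connection_def)

lemma D_cscale:
  assumes "X \<in> vector_fields A" "Y \<in> vector_fields A"
  shows "D (c *\<^sub>C X) Y = c *\<^sub>C D X Y" "D X (c *\<^sub>C Y) = c *\<^sub>C D X Y"
proof -
  have "D (c *\<^sub>C X) Y = c *\<^sub>C D X Y"
    and "D X (c *\<^sub>C Y) = deriv_along X (\<lambda>_. c) *\<^sub>F Y + c *\<^sub>C D X Y"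
    using connection assms smooth_functions_const[of c A]
    unfolding affine_connection_def by blast+
  then show "D (c *\<^sub>C X) Y = c *\<^sub>C D X Y" "D X (c *\<^sub>C Y) = c *\<^sub>C D X Y"
    using assms by (auto simp: deriv_along_const[OF atlas] fscale_def tscale_def fun_eq_iff)
qed

lemma D_frame_left:
  "X \<in> vector_fields A \<Longrightarrow>
    D (frame a b c) X = a *\<^sub>C D e1 X + b *\<^sub>C D e2 X + c *\<^sub>C D e3 X"
  by (simp add: frame_def D_add D_cscale add_in cscale_in e_in)

lemma D_frame_right:
  "X \<in> vector_fields A \<Longrightarrow>
    D X (frame a b c) = a *\<^sub>C D X e1 + b *\<^sub>C D X e2 + c *\<^sub>C D X e3"
  by (simp add: frame_def D_add D_cscale add_in cscale_in e_in)

lemma torsion_free: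
  "X \<in> vector_fields A \<Longrightarrow> Y \<in> vector_fields A \<Longrightarrow> lie_bracket X Y = D X Y - D Y X"
  using levi_civita by (simp add: levi_civita_def)

text \<open>The derivative of the constant \<open>r\<close> is zero, so compatibility with the
  metric becomes skewness of \<open>D X\<close> on the pair \<open>Y\<close>,
  \<open>Z\<close>.\<close>

lemma metric_compatible:
  assumes "X \<in> vector_fields A" "Y \<in> vector_fields A" "Z \<in> vector_fields A"
    and "form_app g Y Z = (\<lambda>_. r)"
  shows "form_app g (D X Y) Z p = - form_app g (D X Z) Y p"
proof -
  have "deriv_along X (form_app g Y Z) = form_app g (D X Y) Z + form_app g Y (D X Z)"
    using levi_civita assms unfolding levi_civita_def by blast
  then have "(\<lambda>_. 0) = form_app g (D X Y) Z + form_app g (D X Z) Y"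
    using assms by (simp add: deriv_along_const[OF atlas] form_app_sym D_in)
  then have "0 = form_app g (D X Y) Z p + form_app g (D X Z) Y p"
    by (metis plus_fun_apply)
  then show ?thesis by simp
qed

text \<open>Inner products of constant combinations are constant, so the derivative terms of
  Koszul's formula drop out. The rest follows from skewness for the three cyclic arrangements, once
  the brackets are expanded by \<open>torsion_free\<close>.\<close>

lemma koszul:
  assumes "X = frame x1 x2 x3" "Y = frame y1 y2 y3" "Z = frame z1 z2 z3"
  shows "2 * form_app g (D X Y) Z p =
    form_app g (lie_bracket X Y) Z p - form_app g (lie_bracket Y Z) X p
    + form_app g (lie_bracket Z X) Y p"
proof -
  have [simp]: "X \<in> vector_fields A" "Y \<in> vector_fields A" "Z \<in> vector_fields A"
    by (simp_all add: assms frame_in)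
  have "form_app g (D X Y) Z p = - form_app g (D X Z) Y p"
    "form_app g (D Y Z) X p = - form_app g (D Y X) Z p"
    "form_app g (D Z X) Y p = - form_app g (D Z Y) X p"
    using metric_compatible[of X Y Z] metric_compatible[of Y Z X] metric_compatible[of Z X Y]
    by (simp_all add: assms form_app_frame frame_in)
  then show ?thesis
    by (simp add: torsion_free form_app_diff D_in)
qed

text \<open>The right-hand side of \<open>koszul\<close> against each frame field determines the
  coefficients through \<open>eq_frame\<close>. For frame fields \<open>X\<close> and
  \<open>Y\<close> the premises can be checked from a table of brackets alone.\<close>

lemma D_eqI:
  assumes "X = frame x1 x2 x3" "Y = frame y1 y2 y3"
    and "\<And>p. form_app g (lie_bracket X Y) e1 p - form_app g (lie_bracket Y e1) X p
        + form_app g (lie_bracket e1 X) Y p = 2 * a"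
    and "\<And>p. form_app g (lie_bracket X Y) e2 p - form_app g (lie_bracket Y e2) X p
        + form_app g (lie_bracket e2 X) Y p = 2 * b"
    and "\<And>p. form_app g (lie_bracket X Y) e3 p - form_app g (lie_bracket Y e3) X p
        + form_app g (lie_bracket e3 X) Y p = - 2 * c"
  shows "D X Y = frame a b c"
proof (rule eq_frame)
  show "D X Y \<in> vector_fields A" by (simp add: assms(1,2) D_in frame_in)
  show "form_app g (D X Y) e1 = (\<lambda>_. a)"
    using koszul[OF assms(1,2) e_eq_frame(1)] assms(3) by (simp add: fun_eq_iff)
  show "form_app g (D X Y) e2 = (\<lambda>_. b)"
    using koszul[OF assms(1,2) e_eq_frame(2)] assms(4) by (simp add: fun_eq_iff)
  show "form_app g (D X Y) e3 = (\<lambda>_. - c)"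
    using koszul[OF assms(1,2) e_eq_frame(3)] assms(5) by (simp add: fun_eq_iff)
qed

end

section \<open>The group \<open>G\<^sub>1\<close>\<close>

locale G1_frame = levi_civita_frame A g e1 e2 e3 D
  for A :: "('m::{t2_space, second_countable_topology}, real^3) atlas"
    and g and e1 e2 e3 :: "'m vfield" and D +
  fixes \<alpha> \<beta> :: real and J :: "'m endo"
  assumes brackets:
      "lie_bracket e1 e2 = \<alpha> *\<^sub>C e1 - \<beta> *\<^sub>C e3"
      "lie_bracket e1 e3 = - (\<alpha> *\<^sub>C e1) - \<beta> *\<^sub>C e2"
      "lie_bracket e2 e3 = \<beta> *\<^sub>C e1 + \<alpha> *\<^sub>C e2 + \<alpha> *\<^sub>C e3"
    and product: "product_structure A J"
    and J_e: "endo_app J e1 = e1" "endo_app J e2 = e2" "endo_app J e3 = - e3"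
begin

lemma bracket_e:
  "lie_bracket e1 e1 = frame 0 0 0" "lie_bracket e2 e2 = frame 0 0 0" "lie_bracket e3 e3 = frame 0 0 0"
  "lie_bracket e1 e2 = frame \<alpha> 0 (- \<beta>)" "lie_bracket e2 e1 = frame (- \<alpha>) 0 \<beta>"
  "lie_bracket e1 e3 = frame (- \<alpha>) (- \<beta>) 0" "lie_bracket e3 e1 = frame \<alpha> \<beta> 0"
  "lie_bracket e2 e3 = frame \<beta> \<alpha> \<alpha>" "lie_bracket e3 e2 = frame (- \<beta>) (- \<alpha>) (- \<alpha>)"
proof -
  have *: "lie_bracket Y X = - lie_bracket X Y" for X Y :: "'m vfield"
    by (simp add: lie_bracket_def fun_eq_iff)
  show 1: "lie_bracket e1 e2 = frame \<alpha> 0 (- \<beta>)" "lie_bracket e1 e3 = frame (- \<alpha>) (- \<beta>) 0"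
    "lie_bracket e2 e3 = frame \<beta> \<alpha> \<alpha>"
    unfolding brackets by (auto simp: fun_eq_iff frame_apply fscale_def tscale_def)
  show "lie_bracket e2 e1 = frame (- \<alpha>) 0 \<beta>" "lie_bracket e3 e1 = frame \<alpha> \<beta> 0"
    "lie_bracket e3 e2 = frame (- \<beta>) (- \<alpha>) (- \<alpha>)"
    using *[of e2 e1] *[of e3 e1] *[of e3 e2] by (simp_all add: 1 frame_arith)
  show "lie_bracket e1 e1 = frame 0 0 0" "lie_bracket e2 e2 = frame 0 0 0"
    "lie_bracket e3 e3 = frame 0 0 0"
    by (auto simp: lie_bracket_def fun_eq_iff frame_apply)
qed

lemma D_e:
  "D e1 e1 = frame 0 (- \<alpha>) (- \<alpha>)"
  "D e1 e2 = frame \<alpha> 0 (- \<beta> / 2)"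
  "D e1 e3 = frame (- \<alpha>) (- \<beta> / 2) 0"
  "D e2 e1 = frame 0 0 (\<beta> / 2)"
  "D e2 e2 = frame 0 0 \<alpha>"
  "D e2 e3 = frame (\<beta> / 2) \<alpha> 0"
  "D e3 e1 = frame 0 (\<beta> / 2) 0"
  "D e3 e2 = frame (- \<beta> / 2) 0 (- \<alpha>)"
  "D e3 e3 = frame 0 (- \<alpha>) 0"
  \<comment> \<open>The optional rule instantiates the coefficients of the two frame fields left
    open by \<open>D_eqI\<close>; the remaining goals are evaluated with the bracket table.\<close>
  by (rule D_eqI; (rule e_eq_frame)?; simp add: bracket_e form_app_frame_left e_in form_app_e)+

lemma J_frame: "endo_app J (frame a b c) = frame a b (- c)"
proof
  fix p
  have J: "J p (a *\<^sub>T u + b *\<^sub>T v) = a *\<^sub>T J p u + b *\<^sub>T J p v"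
    if "u \<in> tangent_space A p" "v \<in> tangent_space A p" for a b u v
    using product that unfolding product_structure_def by blast
  have "J p (1 *\<^sub>T (a *\<^sub>T e1 p + b *\<^sub>T e2 p) + c *\<^sub>T e3 p) =
      1 *\<^sub>T (a *\<^sub>T J p (e1 p) + b *\<^sub>T J p (e2 p)) + c *\<^sub>T J p (e3 p)"
    by (simp add: J tangent_space_lincomb vfield_in_tangent e_in)
  moreover have "1 *\<^sub>T (a *\<^sub>T e1 p + b *\<^sub>T e2 p) + c *\<^sub>T e3 p = frame a b c p"
    by (auto simp: frame_apply tscale_def)
  moreover have "J p (e1 p) = e1 p" "J p (e2 p) = e2 p" "J p (e3 p) = - e3 p"
    using J_e by (auto simp: endo_app_def fun_eq_iff)
  ultimately show "endo_app J (frame a b c) p = frame a b (- c) p"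
    by (auto simp: endo_app_def frame_apply tscale_def)
qed

lemma D_frame:
  "D (frame x1 x2 x3) (frame y1 y2 y3) = frame
     (\<alpha> * x1 * y2 - \<alpha> * x1 * y3 + \<beta> / 2 * x2 * y3 - \<beta> / 2 * x3 * y2)
     (- \<alpha> * x1 * y1 - \<beta> / 2 * x1 * y3 + \<alpha> * x2 * y3 + \<beta> / 2 * x3 * y1 - \<alpha> * x3 * y3)
     (- \<alpha> * x1 * y1 - \<beta> / 2 * x1 * y2 + \<beta> / 2 * x2 * y1 + \<alpha> * x2 * y2 - \<alpha> * x3 * y2)"
  by (simp add: D_frame_left D_frame_right frame_in e_in D_e frame_arith)
    (simp add: algebra_simps)

text \<open>Torsion-freeness yields the bracket as the antisymmetrization of \<open>D_frame\<close>,
  so bilinearity is inherited from the connection.\<close>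

lemma bracket_frame:
  "lie_bracket (frame x1 x2 x3) (frame y1 y2 y3) = frame
     (\<alpha> * (x1 * y2 - x2 * y1) - \<alpha> * (x1 * y3 - x3 * y1) + \<beta> * (x2 * y3 - x3 * y2))
     (- \<beta> * (x1 * y3 - x3 * y1) + \<alpha> * (x2 * y3 - x3 * y2))
     (- \<beta> * (x1 * y2 - x2 * y1) + \<alpha> * (x2 * y3 - x3 * y2))"
  unfolding torsion_free[OF frame_in frame_in] D_frame frame_arith
  by (intro arg_cong3[of _ _ _ _ _ _ frame]) (simp_all add: field_simps)

abbreviation "D0 \<equiv> canonical_connection D J"

text \<open>The canonical connection makes \<open>e3\<close> parallel and acts by infinitesimal rotations on the
  plane of \<open>e1\<close>, \<open>e2\<close>. These commute, so only the bracket term of the curvature survives.\<close>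

lemma canonical_frame:
  "D0 (frame x1 x2 x3) (frame y1 y2 y3) =
     frame ((\<alpha> * x1 - \<beta> / 2 * x3) * y2) (- (\<alpha> * x1 - \<beta> / 2 * x3) * y1) 0"
  unfolding canonical_connection_def cov_deriv_endo_def J_frame D_frame frame_arith
  by (intro arg_cong3[of _ _ _ _ _ _ frame]) (simp_all add: field_simps)

text \<open>Since \<open>D0\<close> is linear in its first argument, the surviving bracket term can
  be written as \<open>D0\<close> along the negated bracket, which \<open>canonical_frame\<close>
  evaluates.\<close>

lemma curvature_frame:
  "curvature D0 (frame x1 x2 x3) (frame y1 y2 y3) (frame z1 z2 z3) =
     D0 (- lie_bracket (frame x1 x2 x3) (frame y1 y2 y3)) (frame z1 z2 z3)"
  unfolding curvature_def bracket_frame frame_arith canonical_frame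
  by (intro arg_cong3[of _ _ _ _ _ _ frame]) (simp_all add: algebra_simps)

text \<open>The curvature takes values in the plane of \<open>e1\<close> and \<open>e2\<close>, so
  the \<open>e3\<close> term of the trace vanishes. What remains is \<omega>([X,e1]) y2 -
  \<omega>([X,e2]) y1, which is not symmetric in X and Y.\<close>

lemma ricci_frame:
  "ricci g D0 e1 e2 e3 (frame x1 x2 x3) (frame y1 y2 y3) p =
     - (\<alpha>\<^sup>2 + \<beta>\<^sup>2 / 2) * (x1 * y1 + x2 * y2) + \<alpha> * \<beta> / 2 * (x3 * y1) + \<alpha>\<^sup>2 * (x3 * y2)"
proof -
  note R = curvature_frame[of x1 x2 x3 _ _ _ y1 y2 y3,
      unfolded bracket_frame frame_arith canonical_frame]
  show ?thesis
    \<comment> \<open>These instances put \<open>e1\<close>, \<open>e2\<close>, \<open>e3\<close>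
      into the second slot of the curvature; the reversed \<open>e_eq_frame\<close> folds the unit
      combinations back into the form in which \<open>ricci_def\<close> mentions them.\<close>
    using R[of 1 0 0] R[of 0 1 0] R[of 0 0 1]
    by (simp add: e_eq_frame[symmetric] ricci_def form_app_frame_left e_in form_app_e)
      (simp add: field_simps power2_eq_square)
qed

lemma sym_ricci_frame:
  "sym_ricci g D0 e1 e2 e3 (frame x1 x2 x3) (frame y1 y2 y3) = (\<lambda>_.
     - (\<alpha>\<^sup>2 + \<beta>\<^sup>2 / 2) * (x1 * y1 + x2 * y2) + \<alpha> * \<beta> / 4 * (x1 * y3 + x3 * y1)
     + \<alpha>\<^sup>2 / 2 * (x2 * y3 + x3 * y2))"
  unfolding sym_ricci_def ricci_frame by (rule ext) (simp add: field_simps)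

section \<open>The collineation equations\<close>

lemma collineation_sym_ricci:
  assumes "left_invariant_ricci_collineation A mul g D0 e1 e2 e3 (frame x y z)"
  shows "0 =
      sym_ricci g D0 e1 e2 e3 (lie_bracket (frame x y z) (frame a b c)) (frame a' b' c') p +
      sym_ricci g D0 e1 e2 e3 (frame a b c) (lie_bracket (frame x y z) (frame a' b' c')) p"
proof -
  have "lie_derivative2 (frame x y z) (sym_ricci g D0 e1 e2 e3) (frame a b c) (frame a' b' c') = 0"
    using assms frame_in unfolding left_invariant_ricci_collineation_def by blast
  from fun_cong[OF this, of p] show ?thesis
    \<comment> \<open>On constant combinations \<open>sym_ricci\<close> is a constant function, so
      its derivative along \<xi> is zero and only the two bracket terms are left.\<close>
    unfolding lie_derivative2_def
    by (simp add: sym_ricci_frame bracket_frame deriv_along_const[OF atlas frame_in])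
qed

lemma collineation_zero:
  assumes "\<alpha> \<noteq> 0" and "left_invariant_ricci_collineation A mul g D0 e1 e2 e3 (frame x y z)"
  shows "frame x y z = 0"
proof -
  note L = collineation_sym_ricci[OF assms(2)]
  \<comment> \<open>The diagonal entries (1,1), (2,2), (3,3) and then the entry (1,2) are written
    out in turn. Each has an overall factor \<alpha>, cancelled by the hypothesis.\<close>
  have "\<alpha> * ((2 * \<alpha>\<^sup>2 + 3 / 2 * \<beta>\<^sup>2) * y - (2 * \<alpha>\<^sup>2 + \<beta>\<^sup>2) * z) = 0"
    using L[of 1 0 0 1 0 0] unfolding bracket_frame sym_ricci_frame by (simp add: field_simps power2_eq_square)
  then have 1: "(2 * \<alpha>\<^sup>2 + 3 / 2 * \<beta>\<^sup>2) * y = (2 * \<alpha>\<^sup>2 + \<beta>\<^sup>2) * z" using assms(1) by simp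
  have "\<alpha> * ((\<alpha>\<^sup>2 + \<beta>\<^sup>2) * z - \<alpha> * \<beta> * x) = 0"
    using L[of 0 1 0 0 1 0] unfolding bracket_frame sym_ricci_frame by (simp add: field_simps power2_eq_square)
  then have 2: "(\<alpha>\<^sup>2 + \<beta>\<^sup>2) * z = \<alpha> * \<beta> * x" using assms(1) by simp
  have "\<alpha> * ((2 * \<alpha>\<^sup>2 + \<beta>\<^sup>2) * y - 3 * \<alpha> * \<beta> * x) = 0"
    using L[of 0 0 1 0 0 1] unfolding bracket_frame sym_ricci_frame by (simp add: field_simps power2_eq_square)
  then have 3: "(2 * \<alpha>\<^sup>2 + \<beta>\<^sup>2) * y = 3 * \<alpha> * \<beta> * x" using assms(1) by simp
  \<comment> \<open>In the diagonal entries \<open>x\<close> occurs only with the factor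
    \<open>\<alpha> * \<beta>\<close>, which vanishes for \<beta> = 0. Here its coefficient is
    positive for every \<beta>.\<close>
  have "\<alpha> * ((4 * \<alpha>\<^sup>2 + 3 * \<beta>\<^sup>2) * x - 2 * \<alpha> * \<beta> * y + \<alpha> * \<beta> * z) = 0"
    using L[of 1 0 0 0 1 0] unfolding bracket_frame sym_ricci_frame by (simp add: field_simps power2_eq_square)
  then have 4: "(4 * \<alpha>\<^sup>2 + 3 * \<beta>\<^sup>2) * x = 2 * \<alpha> * \<beta> * y - \<alpha> * \<beta> * z"
    using assms(1) by simp
  have "((2 * \<alpha>\<^sup>2 + 3 / 2 * \<beta>\<^sup>2) * (3 * (\<alpha>\<^sup>2 + \<beta>\<^sup>2)) - (2 * \<alpha>\<^sup>2 + \<beta>\<^sup>2)\<^sup>2) * z = 0"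
    using 1 2 3 by algebra
  \<comment> \<open>After expansion all coefficients are positive, so the pure power of \<alpha>
    forces strict positivity.\<close>
  moreover have "(2 * \<alpha>\<^sup>2 + 3 / 2 * \<beta>\<^sup>2) * (3 * (\<alpha>\<^sup>2 + \<beta>\<^sup>2)) - (2 * \<alpha>\<^sup>2 + \<beta>\<^sup>2)\<^sup>2 =
      2 * (\<alpha>\<^sup>2)\<^sup>2 + 13 / 2 * (\<alpha>\<^sup>2 * \<beta>\<^sup>2) + 7 / 2 * (\<beta>\<^sup>2)\<^sup>2"
    by (simp add: field_simps power2_eq_square)
  moreover have "\<dots> > 0" using assms(1) by (intro add_pos_nonneg) auto
  ultimately have z: "z = 0" by simp
  have "2 * \<alpha>\<^sup>2 + 3 / 2 * \<beta>\<^sup>2 > 0" using assms(1) by (intro add_pos_nonneg) auto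
  with 1 z have y: "y = 0" by simp
  have "4 * \<alpha>\<^sup>2 + 3 * \<beta>\<^sup>2 > 0" using assms(1) by (intro add_pos_nonneg) auto
  with 4 z y have "x = 0" by simp
  with y z show ?thesis by (simp add: frame_zero)
qed

end

theorem theorem3p3:
  fixes \<alpha> \<beta> :: real
    and A :: "('g::{t2_space, second_countable_topology}, real^3) atlas"
    and mul :: "'g \<Rightarrow> 'g \<Rightarrow> 'g" and one :: 'g and ginv :: "'g \<Rightarrow> 'g"
    and g :: "'g form2" and J :: "'g endo" and nabla :: "'g connection"
    and e1 e2 e3 :: "'g vfield"
  assumes "\<alpha> \<noteq> 0"
    and "lie_group A mul one ginv"
    and "connected (UNIV :: 'g set)"
    and "unimodular mul"
    and "lorentzian_metric A g" and "left_invariant_form A mul g"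
    and "lie_algebra_basis A mul e1 e2 e3"
    and "pseudo_orthonormal g e1 e2 e3"
    and "lie_bracket e1 e2 = \<alpha> *\<^sub>C e1 - \<beta> *\<^sub>C e3"
    and "lie_bracket e1 e3 = - (\<alpha> *\<^sub>C e1) - \<beta> *\<^sub>C e2"
    and "lie_bracket e2 e3 = \<beta> *\<^sub>C e1 + \<alpha> *\<^sub>C e2 + \<alpha> *\<^sub>C e3"
    and "product_structure A J" and "left_invariant_endo A mul J"
    and "endo_app J e1 = e1" and "endo_app J e2 = e2" and "endo_app J e3 = - e3"
    and "levi_civita A g nabla"
  shows "\<not> admits_left_invariant_ricci_collineations A mul g
           (canonical_connection nabla J) e1 e2 e3"
proof -
  interpret G1_frame A g e1 e2 e3 nabla \<alpha> \<beta> J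
    using assms
    by unfold_locales
      (auto simp: lie_group_def lie_algebra_basis_def left_invariant_fields_def)
  show ?thesis
  proof
    assume "admits_left_invariant_ricci_collineations A mul g
      (canonical_connection nabla J) e1 e2 e3"
    then obtain \<xi> where \<xi>: "\<xi> \<noteq> 0"
      "left_invariant_ricci_collineation A mul g (canonical_connection nabla J) e1 e2 e3 \<xi>"
      unfolding admits_left_invariant_ricci_collineations_def by blast
    \<comment> \<open>A collineation is left-invariant by definition, so the spanning clause of
      \<open>lie_algebra_basis\<close> supplies constant coefficients.\<close>
    then obtain x y z where "\<xi> = frame x y z"
      using assms(7)
      unfolding left_invariant_ricci_collineation_def lie_algebra_basis_def frame_def by blast
    with \<xi> collineation_zero[OF assms(1)] show False by blast
  qed
qed

end
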